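(* For any $\mathscr{B}\subset\mathbb{N}$, each point $x\in X_\eta$ is proximal to a point in the orbit closure of a Toeplitz sequence.
   Context: $\mathbb{N}=\{1,2,\dots\}$. For $\mathscr{B}\subset\mathbb{N}$ let $\mathcal{M}_{\mathscr{B}}:=\bigcup_{b\in\mathscr{B}}b\mathbb{Z}$, $\mathcal{F}_{\mathscr{B}}:=\mathbb{Z}\setminus\mathcal{M}_{\mathscr{B}}$, and let $\eta\in\{0,1\}^{\mathbb{Z}}$ be the characteristic function of $\mathcal{F}_{\mathscr{B}}$. $\{0,1\}^{\mathbb{Z}}$ carries the product topology (with a compatible metric $d$), $S$ is the left shift, $(Sx)(n)=x(n+1)$, and $X_\eta$ is the closure of $\{S^m\eta : m\in\mathbb{Z}\}$. Points $x,y$ are proximal if $\liminf_{n\to\infty}d(S^nx,S^ny)=0$. A sequence $x\in\{0,1\}^{\mathbb{Z}}$ is a Toeplitz sequence if for any $n\in\mathbb{Z}$ there exists $d_n\in\mathbb{N}$ such that $x(n+k d_n)=x(n)$ for all $k\in\mathbb{Z}$ (periodic sequences are included). The orbit closure of $x$ is the closure of $\{S^m x: m\in\mathbb{Z}\}$. *)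

theory Defs
  imports "HOL-Analysis.Analysis"
begin

text \<open>
  The space of two-sided 0-1 sequences is the type \<open>int \<Rightarrow> bool\<close>, where \<open>True\<close> stands for 1.
  Its type-class topology is the product topology of the discrete topology on \<open>bool\<close>.
\<close>

type_synonym bseq = "int \<Rightarrow> bool"

definition multiples_of :: "nat set \<Rightarrow> int set" where
  "multiples_of B = (\<Union>b\<in>B. {int b * k |k. True})"

definition free_numbers :: "nat set \<Rightarrow> int set" where
  "free_numbers B = UNIV - multiples_of B"

definition eta :: "nat set \<Rightarrow> bseq" where
  "eta B = (\<lambda>n. n \<in> free_numbers B)"

definition shift :: "bseq \<Rightarrow> bseq" where
  "shift x = (\<lambda>n. x (n + 1))"

text \<open>The integer powers of the shift in closed form; the two lemmas below determine them as
  the iterates of \<open>shift\<close> and its inverse.\<close>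

definition shift_pow :: "int \<Rightarrow> bseq \<Rightarrow> bseq" where
  "shift_pow m x = (\<lambda>n. x (n + m))"

lemma shift_pow_of_nat: "shift_pow (int n) = shift ^^ n"
proof (induction n)
  case 0
  show ?case by (simp add: shift_pow_def fun_eq_iff)
next
  case (Suc n)
  then show ?case
    by (simp add: shift_def shift_pow_def fun_eq_iff flip: Suc.IH) (simp add: algebra_simps)
qed

lemma shift_pow_add: "shift_pow (m + k) = shift_pow m \<circ> shift_pow k"
  by (simp add: shift_pow_def fun_eq_iff algebra_simps)

definition orbit_closure :: "bseq \<Rightarrow> bseq set" where
  "orbit_closure x = closure (range (\<lambda>m. shift_pow m x))"

definition toeplitz :: "bseq \<Rightarrow> bool" where
  "toeplitz x \<longleftrightarrow> (\<forall>n. \<exists>p::nat. p > 0 \<and> (\<forall>k::int. x (n + k * int p) = x n))"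

text \<open>
  No particular metric is singled out. By compactness, any two compatible metrics give the same
  proximality relation.
\<close>

definition compatible_metric :: "(bseq \<Rightarrow> bseq \<Rightarrow> real) \<Rightarrow> bool" where
  "compatible_metric d \<longleftrightarrow>
     Metric_space UNIV d \<and> Metric_space.mtopology UNIV d = (euclidean :: bseq topology)"

lemma compatible_metric_exists: "\<exists>d. compatible_metric d"
proof -
  have "metrizable_space (euclidean :: bool topology)"
  proof -
    have "(euclidean :: bool topology) = discrete_topology UNIV"
      by (simp add: topology_eq open_discrete flip: open_openin)
    then show ?thesis by simp
  qed
  then have "metrizable_space (euclidean :: bseq topology)"
    by (simp add: metrizable_space_product_topology flip: euclidean_product_topology)
  then obtain M d where "Metric_space M d"
    and top: "(euclidean :: bseq topology) = Metric_space.mtopology M d"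
    unfolding metrizable_space_def by auto
  then have "M = UNIV"
    using Metric_space.topspace_mtopology topspace_euclidean by metis
  then show ?thesis
    using \<open>Metric_space M d\<close> top unfolding compatible_metric_def by metis
qed

definition proximal :: "(bseq \<Rightarrow> bseq \<Rightarrow> real) \<Rightarrow> bseq \<Rightarrow> bseq \<Rightarrow> bool" where
  "proximal d x y \<longleftrightarrow> liminf (\<lambda>n. ereal (d ((shift ^^ n) x) ((shift ^^ n) y))) = 0"

end

theory Submission
  imports Defs
begin

text \<open>
  The idea is to enlarge \<open>B\<close> to a set \<open>B'\<close> for which \<open>t = eta B'\<close> is a Toeplitz sequence, but so
  economically that \<open>t\<close> agrees with \<open>eta B\<close> on arbitrarily long windows that recur with bounded gaps.

  View the multiples of \<open>B\<close> as the integer points of the open set \<open>E\<close>, the union of all \<open>b\<close>-multiples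
  in the profinite integers. The set \<open>B'\<close> (\<open>divisor_hull B\<close>) consists of the positive integers that lie
  in the closure of \<open>E\<close>. This makes \<open>eta B'\<close> Toeplitz: a multiple of \<open>c \<in> B'\<close> stays one under shifts by
  \<open>c\<close>, and a number outside the closure has a whole residue class outside it
  (\<open>toeplitz_eta_divisor_hull\<close>). The two sequences differ only on the boundary of the open set \<open>E\<close>. This
  boundary is nowhere dense, and so is a finite union of its translates; hence some residue class avoids
  all of them, which gives agreement on a given window along an arithmetic progression
  (\<open>eta_agrees_on_progression\<close>).

  Compactness transports this to \<open>x\<close>. In the closure of the joint orbit of \<open>(eta B, t)\<close> there is a
  point \<open>(x, y)\<close> over \<open>x\<close>. Having a window of agreement at distance less than \<open>K\<close> is a closed condition
  that holds along the joint orbit, for a \<open>K\<close> that is the same for all its points, so it passes to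
  \<open>(x, y)\<close>. Since the window is arbitrary, \<open>x\<close> and \<open>y\<close> are proximal.
\<close>

section \<open>The Toeplitz sequence\<close>

lemma eta_iff_no_divisor: "eta B n \<longleftrightarrow> (\<forall>b\<in>B. \<not> int b dvd n)"
  by (auto simp: eta_def free_numbers_def multiples_of_def dvd_def)

text \<open>
  A residue class \<open>c + M\<int>\<close> contains a multiple of \<open>b\<close> iff \<open>gcd b M\<close> divides \<open>c\<close>. The hull is therefore the
  set of positive integers in the profinite closure of the multiples of \<open>B\<close>.
\<close>

definition divisor_hull :: "nat set \<Rightarrow> nat set" where
  "divisor_hull B = {c. 0 < c \<and> (\<forall>M>0. \<exists>b\<in>B. gcd b M dvd c)}"

lemma subset_divisor_hull: "0 \<notin> B \<Longrightarrow> B \<subseteq> divisor_hull B"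
  by (auto simp: divisor_hull_def intro!: bexI gr0I)

text \<open>
  At a zero of the sequence, a hull element dividing the position is a period. A nonzero position \<open>n\<close>
  carrying a 1 has its absolute value outside the hull, so some modulus \<open>M\<close> makes \<open>gcd b M\<close> fail to divide
  \<open>n\<close> for every \<open>b \<in> B\<close>. This failure depends on \<open>n\<close> modulo \<open>M\<close> only, and it excludes hull divisors
  because each of them is a multiple of some \<open>gcd b M\<close>; so \<open>M\<close> is a period.
\<close>

lemma toeplitz_eta_divisor_hull:
  assumes "0 \<notin> B" shows "toeplitz (eta (divisor_hull B))"
  unfolding toeplitz_def
proof
  fix n :: int
  show "\<exists>p::nat. p > 0 \<and> (\<forall>k::int. eta (divisor_hull B) (n + k * int p) = eta (divisor_hull B) n)"
  proof (cases "eta (divisor_hull B) n")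
    case False
    then obtain c where c: "c \<in> divisor_hull B" "int c dvd n" by (auto simp: eta_iff_no_divisor)
    have "\<not> eta (divisor_hull B) (n + k * int c)" for k
      using c by (auto simp: eta_iff_no_divisor intro!: bexI[of _ c])
    then show ?thesis using c False by (auto simp: divisor_hull_def)
  next
    case True
    have "\<exists>M>0. \<forall>b\<in>B. \<not> int (gcd b M) dvd n"
    proof (cases "n = 0")
      case True
      \<comment> \<open>Zero is a multiple of everything, so it can only be free if there is nothing to divide it.\<close>
      with \<open>eta (divisor_hull B) n\<close> have "divisor_hull B = {}" by (auto simp: eta_iff_no_divisor)
      with subset_divisor_hull[OF assms] show ?thesis by auto
    next
      case False
      have "nat \<bar>n\<bar> \<notin> divisor_hull B" using \<open>eta (divisor_hull B) n\<close> by (auto simp: eta_iff_no_divisor)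
      with False show ?thesis by (auto simp: divisor_hull_def nat_dvd_iff dvd_nat_abs_iff)
    qed
    then obtain M where M: "M > 0" "\<And>b. b \<in> B \<Longrightarrow> \<not> int (gcd b M) dvd n" by auto
    have "eta (divisor_hull B) (n + k * int M)" for k
      unfolding eta_iff_no_divisor
    proof (intro ballI notI)
      fix c assume c: "c \<in> divisor_hull B" "int c dvd n + k * int M"
      then obtain b where b: "b \<in> B" "gcd b M dvd c" using M(1) by (auto simp: divisor_hull_def)
      then have "int (gcd b M) dvd n + k * int M" using c(2) by (meson dvd_trans int_dvd_int_iff)
      moreover have "int (gcd b M) dvd k * int M" by (simp add: dvd_mult)
      ultimately have "int (gcd b M) dvd n" using dvd_add_left_iff by blast
      with M(2) b show False by blast
    qed
    with M(1) True show ?thesis by auto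
  qed
qed

section \<open>Windows of agreement\<close>

text \<open>
  The positions of \<open>F\<close> are treated one at a time, each time refining the progression. If the hull
  has a multiple at position \<open>j\<close> of some term, then, by definition of the hull with the current
  difference \<open>N\<close> as modulus, some \<open>b \<in> B\<close> has a multiple at position \<open>j\<close> of some other term, and with
  the new difference \<open>b * N\<close> both sequences vanish there. Otherwise both are constantly 1 at
  position \<open>j\<close> already.
\<close>

lemma eta_agrees_on_progression:
  assumes "0 \<notin> B" "finite F"
  shows "\<exists>a N. N > 0 \<and> (\<forall>k::int. \<forall>j\<in>F. eta B (a + k * int N + j) = eta (divisor_hull B) (a + k * int N + j))"
  using assms(2)
proof (induction F)
  case empty then show ?case by auto
next
  case (insert j F)
  then obtain a N where N: "N > 0" and
    IH: "\<And>k i. i \<in> F \<Longrightarrow> eta B (a + k * int N + i) = eta (divisor_hull B) (a + k * int N + i)" by auto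
  show ?case
  proof (cases "\<forall>k. eta (divisor_hull B) (a + k * int N + j)")
    case True
    with subset_divisor_hull[OF assms(1)] have "eta B (a + k * int N + j)" for k
      by (auto simp: eta_iff_no_divisor)
    with True IH N show ?thesis by (intro exI[of _ a] exI[of _ N]) auto
  next
    case False
    then obtain k c where c: "c \<in> divisor_hull B" "int c dvd a + k * int N + j" by (auto simp: eta_iff_no_divisor)
    then obtain b where b: "b \<in> B" "gcd b N dvd c" using N by (auto simp: divisor_hull_def)
    then have "gcd (int b) (int N) dvd a + k * int N + j"
      using c(2) by (metis dvd_trans gcd_int_int_eq int_dvd_int_iff)
    then obtain q where q: "a + k * int N + j = gcd (int b) (int N) * q" by (auto simp: dvd_def)
    \<comment> \<open>The Bezout coefficients say which term of the old progression is a multiple of \<open>b\<close> at \<open>j\<close>.\<close>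
    obtain u v where bz: "u * int b + v * int N = gcd (int b) (int N)" using bezout_int by blast
    have uv: "a + k * int N + j = u * q * int b + v * q * int N"
      using q unfolding bz[symmetric] by (simp add: algebra_simps)
    define a' where "a' = a + (k - v * q) * int N"
    have dv: "int b dvd a' + i * int (b * N) + j" for i
    proof -
      have "a' + i * int (b * N) + j = int b * (u * q + i * int N)"
        using uv by (simp add: a'_def algebra_simps)
      then show ?thesis by simp
    qed
    have "eta B (a' + i * int (b * N) + j) = eta (divisor_hull B) (a' + i * int (b * N) + j)" for i
      using dv[of i] b(1) subset_divisor_hull[OF assms(1)] by (auto simp: eta_iff_no_divisor)
    moreover have "eta B (a' + i * int (b * N) + l) = eta (divisor_hull B) (a' + i * int (b * N) + l)" if "l \<in> F" for i l
      using IH[OF that, of "k - v * q + i * int b"] by (simp add: a'_def algebra_simps)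
    moreover have "b * N > 0" using N b(1) assms(1) by (cases b) auto
    ultimately show ?thesis by (intro exI[of _ a'] exI[of _ "b * N"]) auto
  qed
qed

text \<open>
  The bound \<open>K\<close> comes before the shift \<open>m\<close>, which is what allows passing to limits of shifts.
\<close>

lemma eta_agrees_with_bounded_gaps:
  assumes "0 \<notin> B" "finite F"
  shows "\<exists>K::nat. \<forall>m. \<exists>n<K. \<forall>j\<in>F. shift_pow m (eta B) (int n + j) = shift_pow m (eta (divisor_hull B)) (int n + j)"
proof -
  obtain a N where N: "N > 0" and
    eq: "\<And>k j. j \<in> F \<Longrightarrow> eta B (a + k * int N + j) = eta (divisor_hull B) (a + k * int N + j)"
    using eta_agrees_on_progression[OF assms] by blast
  show ?thesis
  proof (rule exI[of _ N], rule allI)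
    fix m :: int
    define n where "n = nat ((a - m) mod int N)"
    have n: "int n = (a - m) mod int N" "n < N" using N by (auto simp: n_def nat_less_iff)
    have "int n + m = a + (- ((a - m) div int N)) * int N"
      using mult_div_mod_eq[of "int N" "a - m"] by (simp add: n(1) algebra_simps)
    then have "int n + j + m = a + (- ((a - m) div int N)) * int N + j" for j by linarith
    then have "shift_pow m (eta B) (int n + j) = shift_pow m (eta (divisor_hull B)) (int n + j)"
      if "j \<in> F" for j
      using eq[OF that] by (simp only: shift_pow_def)
    with n(2) show "\<exists>n<N. \<forall>j\<in>F. shift_pow m (eta B) (int n + j) = shift_pow m (eta (divisor_hull B)) (int n + j)"
      by blast
  qed
qed

section \<open>Passing to the orbit closure\<close>

lemma compact_bseq: "compact (UNIV :: bseq set)"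
proof -
  have "compact (UNIV :: bool set)" by (simp add: finite_imp_compact)
  then have "compact_space (product_topology (\<lambda>_::int. euclidean :: bool topology) UNIV)"
    unfolding compact_space_product_topology by (simp add: compact_space_def)
  then show ?thesis
    unfolding compact_space_def euclidean_product_topology topspace_euclidean compactin_euclidean_iff .
qed

text \<open>
  A point of one orbit closure is a limit of shifts \<open>m\<close>; by compactness the same shifts accumulate in
  the other orbit closure. Projecting the closed joint orbit closure along a compact factor says
  this without choosing sequences.
\<close>

lemma orbit_closure_joint_lift:
  assumes "x \<in> orbit_closure s"
  obtains y where "y \<in> orbit_closure t" "(x, y) \<in> closure (range (\<lambda>m. (shift_pow m s, shift_pow m t)))"
proof -
  let ?C = "closure (range (\<lambda>m. (shift_pow m s, shift_pow m t)))"
  have "compact_space (euclidean :: bseq topology)" using compact_bseq by (simp add: compact_space_def)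
  then have "closed_map (prod_topology euclidean euclidean :: (bseq \<times> bseq) topology) euclidean fst"
    by (rule Abstract_Topological_Spaces.closed_map_fst)
  then have "closed (fst ` ?C)" by (simp add: closed_map_def flip: closed_closedin)
  moreover have "range (\<lambda>m. shift_pow m s) \<subseteq> fst ` ?C" using closure_subset by (force simp: image_iff)
  ultimately have "orbit_closure s \<subseteq> fst ` ?C" unfolding orbit_closure_def by (intro closure_minimal)
  with assms have "x \<in> fst ` ?C" by blast
  then obtain y where y: "(x, y) \<in> ?C" by auto
  have "snd ` ?C \<subseteq> orbit_closure t" unfolding orbit_closure_def
    by (rule image_closure_subset[OF continuous_on_snd[OF continuous_on_id] closed_closure])
       (auto intro: subsetD[OF closure_subset])
  with y have "y \<in> orbit_closure t" by force
  with y that show ?thesis by blast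
qed

lemma closed_agree_within:
  "closed {p :: bseq \<times> bseq. \<exists>n<K::nat. \<forall>j\<in>F. fst p (int n + j) = snd p (int n + j)}"
proof -
  have "closed {p :: bseq \<times> bseq. fst p i = snd p i}" for i
    by (rule closed_Collect_eq; rule continuous_on_product_then_coordinatewise)
       (rule continuous_on_fst continuous_on_snd, rule continuous_on_id)+
  then have "closed (\<Union>n\<in>{..<K}. \<Inter>j\<in>F. {p :: bseq \<times> bseq. fst p (int n + j) = snd p (int n + j)})"
    by auto
  moreover have "\<dots> = {p. \<exists>n<K. \<forall>j\<in>F. fst p (int n + j) = snd p (int n + j)}" by auto
  ultimately show ?thesis by simp
qed

section \<open>Proximality from windows of agreement\<close>

lemma open_contains_cylinder:
  fixes U :: "bseq set"
  assumes "open U" "z \<in> U"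
  shows "\<exists>F. finite F \<and> {v. \<forall>j\<in>F. v j = z j} \<subseteq> U"
proof -
  obtain X where X: "z \<in> (\<Pi>\<^sub>E i\<in>UNIV. X i)" "finite {i. X i \<noteq> (UNIV :: bool set)}"
     "(\<Pi>\<^sub>E i\<in>UNIV. X i) \<subseteq> U"
    using product_topology_open_contains_basis[of "\<lambda>_. euclidean" UNIV U z] assms
    by (auto simp: open_fun_def)
  have "{v. \<forall>j\<in>{i. X i \<noteq> UNIV}. v j = z j} \<subseteq> (\<Pi>\<^sub>E i\<in>UNIV. X i)"
  proof
    fix v assume v: "v \<in> {v. \<forall>j\<in>{i. X i \<noteq> UNIV}. v j = z j}"
    have "v i \<in> X i" for i using v X(1) by (cases "X i = UNIV") (auto simp: PiE_iff)
    then show "v \<in> (\<Pi>\<^sub>E i\<in>UNIV. X i)" by auto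
  qed
  then have "{v. \<forall>j\<in>{i. X i \<noteq> UNIV}. v j = z j} \<subseteq> U"
    using X(3) by (rule subset_trans)
  with X(2) show ?thesis by (intro exI[of _ "{i. X i \<noteq> UNIV}"] conjI)
qed

text \<open>
  Each point has a cylinder inside its ball of radius \<open>e/2\<close>. Finitely many of these cylinders cover
  the compact space; two points agreeing on all coordinates that they constrain share a cylinder.
\<close>

lemma compatible_metric_small_of_agree:
  assumes "compatible_metric d" "e > 0"
  obtains F where "finite F" "\<And>u v. (\<forall>j\<in>F. u j = v j) \<Longrightarrow> d u v < e"
proof -
  interpret Metric_space UNIV d using assms(1) by (simp add: compatible_metric_def)
  have top: "mtopology = (euclidean :: bseq topology)" using assms(1) by (simp add: compatible_metric_def)
  have ex: "\<exists>F. finite F \<and> {v. \<forall>j\<in>F. v j = z j} \<subseteq> mball z (e/2)" for z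
  proof (rule open_contains_cylinder)
    show "open (mball z (e/2))" using openin_mball top by (metis open_openin)
    show "z \<in> mball z (e/2)" using assms(2) by simp
  qed
  define F where "F z = (SOME F. finite F \<and> {v. \<forall>j\<in>F. v j = z j} \<subseteq> mball z (e/2))" for z
  have F: "finite (F z)" "{v. \<forall>j\<in>F z. v j = z j} \<subseteq> mball z (e/2)" for z
    using someI_ex[OF ex[of z], folded F_def] by simp_all
  have op: "open {v :: bseq. \<forall>j\<in>F z. v j = z j}" for z
  proof -
    have "open ((\<lambda>v :: bseq. v j) -` {z j})" for j
      by (intro open_vimage continuous_on_product_coordinates) (rule open_discrete)
    then have "open (\<Inter>j\<in>F z. (\<lambda>v :: bseq. v j) -` {z j})" using F(1) by (intro open_INT) auto
    moreover have "\<dots> = {v. \<forall>j\<in>F z. v j = z j}" by auto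
    ultimately show ?thesis by simp
  qed
  have cov: "UNIV \<subseteq> (\<Union>z\<in>UNIV. {v :: bseq. \<forall>j\<in>F z. v j = z j})" by auto
  obtain Z where Z: "finite Z" "UNIV \<subseteq> (\<Union>z\<in>Z. {v. \<forall>j\<in>F z. v j = z j})"
    by (rule compactE_image[OF compact_bseq op cov])
  show ?thesis
  proof (rule that[of "\<Union>z\<in>Z. F z"])
    show "finite (\<Union>z\<in>Z. F z)" using Z(1) F(1) by auto
    fix u v :: bseq assume eq: "\<forall>j\<in>\<Union>z\<in>Z. F z. u j = v j"
    obtain z where z: "z \<in> Z" "\<forall>j\<in>F z. u j = z j" using Z(2) by blast
    with eq have "\<forall>j\<in>F z. v j = z j" by auto
    then have "d z u < e/2" "d z v < e/2" using z(2) F(2)[of z] by (auto simp: subset_iff)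
    then show "d u v < e" using triangle[of u z v] commute[of u z] by simp
  qed
qed

text \<open>
  Only one time of agreement per window is asked for: translating the window to the right by \<open>N\<close>
  turns a time \<open>n\<close> into a time \<open>n + N\<close>, so there are arbitrarily late times as well.
\<close>

lemma proximal_if_agree_on_windows:
  assumes d: "compatible_metric d"
    and agree: "\<And>F. finite F \<Longrightarrow> \<exists>n::nat. \<forall>j\<in>F. x (int n + j) = y (int n + j)"
  shows "proximal d x y"
proof -
  interpret Metric_space UNIV d using d by (simp add: compatible_metric_def)
  let ?f = "\<lambda>n. ereal (d ((shift ^^ n) x) ((shift ^^ n) y))"
  have "(INF m\<in>{N..}. ?f m) = 0" for N
  proof (rule antisym)
    show "(INF m\<in>{N..}. ?f m) \<le> 0"
    proof (rule ereal_le_epsilon2)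
      fix e :: real assume "e > 0"
      then obtain F where F: "finite F" "\<And>u v. (\<forall>j\<in>F. u j = v j) \<Longrightarrow> d u v < e"
        using compatible_metric_small_of_agree[OF d] by metis
      obtain n where n: "\<forall>j\<in>(\<lambda>j. int N + j) ` F. x (int n + j) = y (int n + j)"
        using agree[of "(\<lambda>j. int N + j) ` F"] F(1) by auto
      have "d ((shift ^^ (n + N)) x) ((shift ^^ (n + N)) y) < e"
        unfolding shift_pow_of_nat[symmetric]
        by (rule F(2)) (use n in \<open>auto simp: shift_pow_def algebra_simps\<close>)
      then show "(INF m\<in>{N..}. ?f m) \<le> 0 + ereal e"
        by (intro INF_lower2[of "n + N"]) auto
    qed
    show "0 \<le> (INF m\<in>{N..}. ?f m)" by (intro INF_greatest) simp
  qed
  then show ?thesis unfolding proximal_def liminf_SUP_INF by simp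
qed

theorem corollary1p4:
  fixes B :: "nat set" and d :: "bseq \<Rightarrow> bseq \<Rightarrow> real" and x :: bseq
  assumes "0 \<notin> B"
    and "compatible_metric d"
    and "x \<in> orbit_closure (eta B)"
  shows "\<exists>t y. toeplitz t \<and> y \<in> orbit_closure t \<and> proximal d x y"
proof -
  let ?t = "eta (divisor_hull B)"
  let ?O = "range (\<lambda>m. (shift_pow m (eta B), shift_pow m ?t))"
  obtain y where y: "y \<in> orbit_closure ?t" "(x, y) \<in> closure ?O"
    using orbit_closure_joint_lift[OF assms(3)] by blast
  have "\<exists>n::nat. \<forall>j\<in>F. x (int n + j) = y (int n + j)" if fin: "finite F" for F
  proof -
    obtain K :: nat where K: "\<And>m. \<exists>n<K. \<forall>j\<in>F. shift_pow m (eta B) (int n + j) = shift_pow m ?t (int n + j)"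
      using eta_agrees_with_bounded_gaps[OF assms(1) fin] by blast
    let ?A = "{p :: bseq \<times> bseq. \<exists>n<K. \<forall>j\<in>F. fst p (int n + j) = snd p (int n + j)}"
    have "?O \<subseteq> ?A" using K by auto
    then have "closure ?O \<subseteq> ?A" by (rule closure_minimal) (rule closed_agree_within)
    with y(2) have "(x, y) \<in> ?A" by blast
    then show ?thesis unfolding mem_Collect_eq fst_conv snd_conv by blast
  qed
  then have "proximal d x y" by (intro proximal_if_agree_on_windows assms(2))
  with y(1) toeplitz_eta_divisor_hull[OF assms(1)] show ?thesis by blast
qed
end
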